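(* Let $\mathcal{M}$ be a factor acting on a Hilbert space $H$, let $x\in H$ be a unit vector which is separating and cyclic for $\mathcal{M}$, and let $E\in B(H)$ be the rank one projection onto $\mathbb{C}x$. Let $k\in\mathbb{N}$, $A_1,\dots,A_k,B_1,\dots,B_k\in\mathcal{M}$, let $\phi\colon\mathcal{M}\to\mathcal{M}$ be defined by $\phi(C)=\sum_{i=1}^k A_iCB_i$, and let $D_\phi=\sum_{i=1}^k B_iEA_i\in B(H)$. Then $D_\phi\geq 0$ if and only if there are finitely many operators $V_j\in\mathcal{M}$ such that $\phi(C)=\sum_j V_j^*CV_j$ for all $C\in\mathcal{M}$.
   Context: A factor is a von Neumann algebra with trivial center. A vector $x$ is cyclic for $\mathcal{M}$ if $\mathcal{M}x$ is dense in $H$, and separating if $A\in\mathcal{M}$, $Ax=0$ imply $A=0$. For an operator $D\in B(H)$, $D\geq 0$ means that $D$ is a positive operator. *)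

theory Defs
  imports "HOL-Analysis.Analysis" "HOL-Library.Nonpos_Ints"
begin

(* Complex Hilbert spaces.  The underlying real inner product space is kept, with inner product
   the real part of the complex one, so that norm, topology and completeness are the library's.
   The complex inner product is linear in the first argument. *)

class complex_inner = real_inner +
  fixes scaleC :: "complex \<Rightarrow> 'a \<Rightarrow> 'a" (infixr "*\<^sub>C" 75)
    and cinner :: "'a \<Rightarrow> 'a \<Rightarrow> complex"
  assumes scaleC_add_right: "c *\<^sub>C (x + y) = c *\<^sub>C x + c *\<^sub>C y"
    and scaleC_add_left: "(c + d) *\<^sub>C x = c *\<^sub>C x + d *\<^sub>C x"
    and scaleC_scaleC: "c *\<^sub>C (d *\<^sub>C x) = (c * d) *\<^sub>C x"
    and scaleC_of_real: "complex_of_real r *\<^sub>C x = r *\<^sub>R x"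
    and cinner_add_left: "cinner (x + y) z = cinner x z + cinner y z"
    and cinner_scaleC_left: "cinner (c *\<^sub>C x) y = c * cinner x y"
    and cinner_commute: "cinner x y = cnj (cinner y x)"
    and Re_cinner: "Re (cinner x y) = inner x y"

class chilbert_space = complex_inner + complete_space

(* B(H): the library type of bounded operators only asks for real linearity. *)

definition bounded_operators :: "('a::chilbert_space \<Rightarrow>\<^sub>L 'a) set" where
  "bounded_operators = {A. \<forall>c x. blinfun_apply A (c *\<^sub>C x) = c *\<^sub>C blinfun_apply A x}"

definition adjoint_op :: "('a::chilbert_space \<Rightarrow>\<^sub>L 'a) \<Rightarrow> 'a \<Rightarrow>\<^sub>L 'a" where
  "adjoint_op A =
    (THE B. \<forall>x y. cinner (blinfun_apply A x) y = cinner x (blinfun_apply B y))"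

definition positive_operator :: "('a::chilbert_space \<Rightarrow>\<^sub>L 'a) \<Rightarrow> bool" where
  "positive_operator D \<longleftrightarrow>
    D \<in> bounded_operators \<and> (\<forall>y. cinner (blinfun_apply D y) y \<in> \<real>\<^sub>\<ge>\<^sub>0)"

definition orthogonal_projection_onto :: "('a::chilbert_space \<Rightarrow>\<^sub>L 'a) \<Rightarrow> 'a set \<Rightarrow> bool" where
  "orthogonal_projection_onto E S \<longleftrightarrow>
    E \<in> bounded_operators \<and> E o\<^sub>L E = E \<and> adjoint_op E = E \<and> range (blinfun_apply E) = S"

definition commutant :: "('a::chilbert_space \<Rightarrow>\<^sub>L 'a) set \<Rightarrow> ('a \<Rightarrow>\<^sub>L 'a) set" where
  "commutant M = {T \<in> bounded_operators. \<forall>A\<in>M. T o\<^sub>L A = A o\<^sub>L T}"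

(* A commutant is automatically a unital complex subalgebra of B(H), so these conditions say that
   M is a unital *-subalgebra of B(H) equal to its bicommutant. *)

definition von_neumann_algebra :: "('a::chilbert_space \<Rightarrow>\<^sub>L 'a) set \<Rightarrow> bool" where
  "von_neumann_algebra M \<longleftrightarrow>
    M \<subseteq> bounded_operators \<and> (\<forall>A\<in>M. adjoint_op A \<in> M) \<and> commutant (commutant M) = M"

definition scalar_operators :: "('a::chilbert_space \<Rightarrow>\<^sub>L 'a) set" where
  "scalar_operators = {Z. \<exists>c. \<forall>y. blinfun_apply Z y = c *\<^sub>C y}"

definition factor :: "('a::chilbert_space \<Rightarrow>\<^sub>L 'a) set \<Rightarrow> bool" where
  "factor M \<longleftrightarrow> von_neumann_algebra M \<and> M \<inter> commutant M = scalar_operators"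

definition cyclic_vector :: "('a::chilbert_space \<Rightarrow>\<^sub>L 'a) set \<Rightarrow> 'a \<Rightarrow> bool" where
  "cyclic_vector M x \<longleftrightarrow> closure {blinfun_apply A x | A. A \<in> M} = UNIV"

definition separating_vector :: "('a::chilbert_space \<Rightarrow>\<^sub>L 'a) set \<Rightarrow> 'a \<Rightarrow> bool" where
  "separating_vector M x \<longleftrightarrow> (\<forall>A\<in>M. blinfun_apply A x = 0 \<longrightarrow> A = 0)"

end

(* If D_phi is positive, a Cholesky decomposition writes it as a sum of W E W^* with W in the span of
   the B_i. As x is separating, an element sum A_i (x) B_i of the algebraic tensor square of M is
   determined by sum B_i E A_i, so phi is the sum of the maps W^* C W.
   Conversely, one has to see that phi determines D_phi. If sum A_i C B_i = 0 for all C in M, then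
   also sum A_i S B_i = 0 for all products S of operators of M and M'. The commutant of these
   products is the center of M, hence trivial, so the projection of H^n onto the annihilator of the
   vectors (S B_1 z, ..., S B_n z) is a scalar matrix. This matrix kills (B_i z) and fixes (A_i^* w),
   and it is self-adjoint, which forces the tensor sum A_i (x) B_i to vanish. *)

theory Submission
  imports Defs
begin

section \<open>Complex inner products and adjoints\<close>

text \<open>Both \<open>\<phi>\<close> and \<open>D\<^sub>\<phi>\<close> are linear images of one
  tensor, and the equivalence rests on each of them determining it. No tensor product is formed:
  that a tensor vanishes is expressed by numbers such as
  \<open>cinner (B i z) v * cinner (A i u) w\<close>, whose sum over \<open>i\<close> must be zero
  for all vectors. Equality of two tensors becomes vanishing of a single one over the disjoint union
  of their index sets, so each direction of the equivalence needs only one vanishing statement. The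
  algebra M may itself act reducibly, since its commutant can contain more than the scalars. This is
  why operators of the commutant are brought in: they move past the coefficients \<open>B i\<close>,
  so an identity assumed for M alone extends to products, and these do act irreducibly.\<close>

lemma scaleC_one [simp]: "1 *\<^sub>C (z::'a::complex_inner) = z"
  using scaleC_of_real[of 1 z] by simp

lemma scaleC_zero_left [simp]: "0 *\<^sub>C (z::'a::complex_inner) = 0"
  using scaleC_of_real[of 0 z] by simp

lemma scaleC_zero_right [simp]: "c *\<^sub>C (0::'a::complex_inner) = 0"
  using scaleC_add_right[of c 0 0] by simp

lemma scaleC_minus_right: "c *\<^sub>C (- z::'a::complex_inner) = - (c *\<^sub>C z)"
  using scaleC_add_right[of c z "- z"] by (simp add: eq_neg_iff_add_eq_0 add.commute)

lemma scaleC_minus_left: "(- c) *\<^sub>C (z::'a::complex_inner) = - (c *\<^sub>C z)"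
  using scaleC_add_left[of c "- c" z] by (simp add: eq_neg_iff_add_eq_0 add.commute)

lemma scaleC_diff_right: "c *\<^sub>C (y - z::'a::complex_inner) = c *\<^sub>C y - c *\<^sub>C z"
  using scaleC_add_right[of c y "- z"] by (simp add: scaleC_minus_right)

lemma scaleC_sum_right: "c *\<^sub>C (\<Sum>i\<in>I. f i::'a::complex_inner) = (\<Sum>i\<in>I. c *\<^sub>C f i)"
  by (induction I rule: infinite_finite_induct) (simp_all add: scaleC_add_right)

lemma scaleC_sum_left: "(\<Sum>i\<in>I. c i) *\<^sub>C (z::'a::complex_inner) = (\<Sum>i\<in>I. c i *\<^sub>C z)"
  by (induction I rule: infinite_finite_induct) (simp_all add: scaleC_add_left)

lemma scaleC_scaleR: "c *\<^sub>C (r *\<^sub>R (z::'a::complex_inner)) = r *\<^sub>R (c *\<^sub>C z)"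
  by (simp add: scaleC_of_real[symmetric] scaleC_scaleC mult.commute)

lemma cinner_add_right: "cinner (z::'a::complex_inner) (u + v) = cinner z u + cinner z v"
  by (metis cinner_add_left cinner_commute complex_cnj_add)

lemma cinner_scaleC_right: "cinner (z::'a::complex_inner) (c *\<^sub>C v) = cnj c * cinner z v"
  by (metis cinner_commute cinner_scaleC_left complex_cnj_mult)

lemma cinner_zero_left [simp]: "cinner (0::'a::complex_inner) z = 0"
  using cinner_scaleC_left[of 0 0 z] by simp

lemma cinner_zero_right [simp]: "cinner (z::'a::complex_inner) 0 = 0"
  using cinner_scaleC_right[of z 0 0] by simp

lemma cinner_minus_left: "cinner (- z::'a::complex_inner) v = - cinner z v"
  using cinner_add_left[of z "- z" v] by (simp add: eq_neg_iff_add_eq_0 add.commute)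

lemma cinner_minus_right: "cinner (z::'a::complex_inner) (- v) = - cinner z v"
  using cinner_add_right[of z v "- v"] by (simp add: eq_neg_iff_add_eq_0 add.commute)

lemma cinner_diff_left: "cinner (u - v::'a::complex_inner) z = cinner u z - cinner v z"
  using cinner_add_left[of u "- v" z] by (simp add: cinner_minus_left)

lemma cinner_diff_right: "cinner (z::'a::complex_inner) (u - v) = cinner z u - cinner z v"
  using cinner_add_right[of z u "- v"] by (simp add: cinner_minus_right)

lemma cinner_sum_left: "cinner (\<Sum>i\<in>I. f i::'a::complex_inner) z = (\<Sum>i\<in>I. cinner (f i) z)"
  by (induction I rule: infinite_finite_induct) (simp_all add: cinner_add_left)

lemma cinner_sum_right: "cinner (z::'a::complex_inner) (\<Sum>i\<in>I. f i) = (\<Sum>i\<in>I. cinner z (f i))"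
  by (induction I rule: infinite_finite_induct) (simp_all add: cinner_add_right)

lemma cinner_self: "cinner (z::'a::complex_inner) z = of_real ((norm z)\<^sup>2)"
proof (rule complex_eqI)
  show "Re (cinner z z) = Re (of_real ((norm z)\<^sup>2))"
    by (simp add: Re_cinner dot_square_norm)
  show "Im (cinner z z) = Im (of_real ((norm z)\<^sup>2))"
    using arg_cong[OF cinner_commute[of z z], of Im] by simp
qed

lemma cinner_eq_zero_iff: "cinner (z::'a::complex_inner) z = 0 \<longleftrightarrow> z = 0"
  by (simp add: cinner_self)

lemma cinner_left_eqI:
  assumes "\<And>v. cinner (z::'a::complex_inner) v = cinner w v"
  shows "z = w"
  using assms[of "z - w"] cinner_eq_zero_iff[of "z - w"] by (simp add: cinner_diff_left)

lemma cinner_right_eqI: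
  assumes "\<And>v. cinner v (z::'a::complex_inner) = cinner v w"
  shows "z = w"
  using assms[of "z - w"] cinner_eq_zero_iff[of "z - w"] by (simp add: cinner_diff_right)

lemma norm_scaleC: "norm (c *\<^sub>C (z::'a::complex_inner)) = cmod c * norm z"
proof -
  have "of_real ((norm (c *\<^sub>C z))\<^sup>2) = (of_real ((cmod c * norm z)\<^sup>2) :: complex)"
    unfolding cinner_self[symmetric] cinner_scaleC_left cinner_scaleC_right
    using complex_norm_square[of c] by (simp add: cinner_self power_mult_distrib mult.commute)
  then have "(norm (c *\<^sub>C z))\<^sup>2 = (cmod c * norm z)\<^sup>2"
    using of_real_eq_iff by blast
  then show ?thesis
    by (simp add: power2_eq_iff_nonneg)
qed

lemma norm_cinner_le: "cmod (cinner (z::'a::complex_inner) v) \<le> norm z * norm v"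
proof (cases "cinner z v = 0")
  case False
  \<comment> \<open>This phase has modulus one and rotates the complex inner product onto its
    modulus, so that the real Cauchy-Schwarz inequality applies.\<close>
  define c where "c = cnj (cinner z v) / cmod (cinner z v)"
  have "c * cinner z v = of_real (cmod (cinner z v))"
    using False by (simp add: c_def field_simps complex_norm_square[symmetric] power2_eq_square)
  then have "cmod (cinner z v) = Re (cinner (c *\<^sub>C z) v)"
    by (simp add: cinner_scaleC_left)
  also have "\<dots> \<le> norm (c *\<^sub>C z) * norm v"
    unfolding Re_cinner by (rule norm_cauchy_schwarz)
  also have "norm (c *\<^sub>C z) = norm z"
    using False by (simp add: norm_scaleC c_def norm_divide)
  finally show ?thesis .
qed simp

lemma bounded_linear_cinner_right: "bounded_linear (cinner (z::'a::complex_inner))"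
proof (rule bounded_linear_intro)
  show "cinner z (r *\<^sub>R v) = r *\<^sub>R cinner z v" for r v
    by (simp add: scaleC_of_real[symmetric] cinner_scaleC_right scaleR_conv_of_real)
  show "norm (cinner z v) \<le> norm v * norm z" for v
    using norm_cinner_le[of z v] by (simp add: mult.commute)
qed (rule cinner_add_right)

section \<open>Orthogonal projection in a finite direct sum\<close>

text \<open>Families indexed by a finite set \<open>I\<close> stand for the elements of the direct sum of
  \<open>card I\<close> copies of the Hilbert space, since the number of summands cannot be a type.\<close>

lemma finite_sum_projection:
  fixes L :: "('i \<Rightarrow> 'a::chilbert_space) set"
  assumes I: "finite I"
    and zero: "(\<lambda>i. 0) \<in> L"
    and add: "\<And>g h. g \<in> L \<Longrightarrow> h \<in> L \<Longrightarrow> (\<lambda>i. g i + h i) \<in> L"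
    and scale: "\<And>c g. g \<in> L \<Longrightarrow> (\<lambda>i. c *\<^sub>C g i) \<in> L"
    and closed: "\<And>g h. (\<And>n::nat. g n \<in> L) \<Longrightarrow> (\<And>i. i \<in> I \<Longrightarrow> (\<lambda>n. g n i) \<longlonglongrightarrow> h i) \<Longrightarrow> h \<in> L"
  shows "\<exists>h\<in>L. \<forall>g\<in>L. (\<Sum>i\<in>I. cinner (f i - h i) (g i)) = 0"
proof -
  define q where "q = (\<lambda>g. \<Sum>i\<in>I. (norm (f i - g i :: 'a))\<^sup>2)"
  define d where "d = Inf (q ` L)"
  have bdd: "bdd_below (q ` L)"
    by (rule bdd_belowI[of _ 0]) (auto simp: q_def intro: sum_nonneg)
  have d_le: "d \<le> q g" if "g \<in> L" for g
    unfolding d_def using that bdd by (auto intro: cInf_lower)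
  have "\<exists>g\<in>L. q g < d + 1 / real (Suc n)" for n
    using cInf_lessD[of "q ` L" "d + 1 / real (Suc n)"] zero by (auto simp: d_def)
  then obtain g where gL: "\<And>n. g n \<in> L" and gq: "\<And>n. q (g n) < d + 1 / real (Suc n)"
    by metis
  have dist2: "(dist (g m i) (g n i))\<^sup>2 \<le> 2 / real (Suc m) + 2 / real (Suc n)" if "i \<in> I" for i m n
  proof -
    have scaleR: "(\<lambda>i. r *\<^sub>R u i) \<in> L" if "u \<in> L" for r u
      using scale[OF that, of "of_real r"] by (simp add: scaleC_of_real)
    have mid: "(\<lambda>i. (1/2) *\<^sub>R (g m i + g n i)) \<in> L"
      using scaleR[OF add[OF gL gL]] .
    \<comment> \<open>The parallelogram law: the midpoint of two almost minimizing families lies in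
      \<open>L\<close>, so its distance cannot beat \<open>d\<close>, and this forces the two
      families to be close.\<close>
    have "(norm (f j - g m j - (f j - g n j)))\<^sup>2 = 2 * (norm (f j - g m j))\<^sup>2 + 2 * (norm (f j - g n j))\<^sup>2
        - 4 * (norm (f j - (1/2) *\<^sub>R (g m j + g n j)))\<^sup>2" for j
    proof -
      define u v where "u = f j - g m j" and "v = f j - g n j"
      have "f j - (1/2) *\<^sub>R (g m j + g n j) = (1/2) *\<^sub>R (u + v)"
        by (simp add: u_def v_def algebra_simps flip: scaleR_add_left)
      then show ?thesis
        unfolding u_def[symmetric] v_def[symmetric]
        by (simp add: power2_norm_eq_inner power_mult_distrib algebra_simps inner_commute)
    qed
    then have "(\<Sum>j\<in>I. (norm (f j - g m j - (f j - g n j)))\<^sup>2)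
        = 2 * q (g m) + 2 * q (g n) - 4 * q (\<lambda>i. (1/2) *\<^sub>R (g m i + g n i))"
      by (simp add: q_def sum.distrib sum_subtractf sum_distrib_left)
    also have "\<dots> \<le> 2 / real (Suc m) + 2 / real (Suc n)"
      using d_le[OF mid] gq[of m] gq[of n] by simp
    finally have "(\<Sum>j\<in>I. (norm (f j - g m j - (f j - g n j)))\<^sup>2) \<le> 2 / real (Suc m) + 2 / real (Suc n)" .
    moreover have "(dist (g m i) (g n i))\<^sup>2 \<le> (\<Sum>j\<in>I. (norm (f j - g m j - (f j - g n j)))\<^sup>2)"
      using member_le_sum[of i I "\<lambda>j. (norm (f j - g m j - (f j - g n j)))\<^sup>2"] I that
      by (simp add: dist_norm norm_minus_commute)
    ultimately show ?thesis
      by simp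
  qed
  have "Cauchy (\<lambda>n. g n i)" if i: "i \<in> I" for i
  proof (rule metric_CauchyI)
    fix e :: real
    assume e: "0 < e"
    obtain N where N: "4 / e\<^sup>2 < real N"
      using reals_Archimedean2 by blast
    have "dist (g m i) (g n i) < e" if mn: "N \<le> m" "N \<le> n" for m n
    proof -
      have "0 < 4 / e\<^sup>2"
        using e by simp
      then have N0: "0 < real N"
        using N by linarith
      then have N1: "4 / real N < e\<^sup>2"
        using N e by (simp add: field_simps)
      have "2 / real (Suc m) \<le> 2 / real N" "2 / real (Suc n) \<le> 2 / real N"
        using mn N0 by (auto intro!: divide_left_mono)
      then have "(dist (g m i) (g n i))\<^sup>2 < e\<^sup>2"
        using dist2[OF i, of m n] N1 by simp
      then show ?thesis
        using e by (simp add: power_less_imp_less_base)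
    qed
    then show "\<exists>N. \<forall>m\<ge>N. \<forall>n\<ge>N. dist (g m i) (g n i) < e"
      by blast
  qed
  then have "\<exists>l. (\<lambda>n. g n i) \<longlonglongrightarrow> l" if "i \<in> I" for i
    using that by (simp add: Cauchy_convergent_iff convergent_def)
  \<comment> \<open>Off \<open>I\<close> the values of \<open>h\<close> are arbitrary, which is why
    \<open>closed\<close> asks for convergence at the indices in \<open>I\<close> only.\<close>
  then obtain h where h: "\<And>i. i \<in> I \<Longrightarrow> (\<lambda>n. g n i) \<longlonglongrightarrow> h i"
    by metis
  have hL: "h \<in> L"
    using closed[OF gL h] by blast
  have "(\<lambda>n. q (g n)) \<longlonglongrightarrow> q h"
    unfolding q_def by (intro tendsto_intros h)
  moreover have "(\<lambda>n. d + 1 / real (Suc n)) \<longlonglongrightarrow> d + 0"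
    by (intro tendsto_intros LIMSEQ_inverse_real_of_nat[unfolded inverse_eq_divide])
  ultimately have qh: "q h \<le> d"
    using gq by (intro LIMSEQ_le[of "\<lambda>n. q (g n)" "q h" "\<lambda>n. d + 1 / real (Suc n)"]) (auto intro: less_imp_le)
  have re: "(\<Sum>i\<in>I. inner (f i - h i) (u i)) = 0" if u: "u \<in> L" for u
  proof -
    define \<beta> where "\<beta> = (\<Sum>i\<in>I. inner (f i - h i) (u i))"
    define \<gamma> where "\<gamma> = (\<Sum>i\<in>I. (norm (u i))\<^sup>2)"
    have \<gamma>: "0 \<le> \<gamma>"
      by (auto simp: \<gamma>_def intro: sum_nonneg)
    have "2 * t * \<beta> \<le> t\<^sup>2 * \<gamma>" for t :: real
    proof -
      have "(\<lambda>i. h i + t *\<^sub>R u i) \<in> L"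
        using add[OF hL scale[OF u, of "of_real t"]] by (simp add: scaleC_of_real)
      then have "q h \<le> q (\<lambda>i. h i + t *\<^sub>R u i)"
        using qh d_le by force
      also have "(norm (f i - (h i + t *\<^sub>R u i)))\<^sup>2
          = (norm (f i - h i))\<^sup>2 - 2 * t * inner (f i - h i) (u i) + t\<^sup>2 * (norm (u i))\<^sup>2" for i
      proof -
        have "f i - (h i + t *\<^sub>R u i) = (f i - h i) - t *\<^sub>R u i"
          by simp
        then show ?thesis
          using dot_norm_neg[of "f i - h i" "t *\<^sub>R u i"] by (simp only:) (simp add: power_mult_distrib)
      qed
      then have "q (\<lambda>i. h i + t *\<^sub>R u i) = q h - 2 * t * \<beta> + t\<^sup>2 * \<gamma>"
        by (simp add: q_def \<beta>_def \<gamma>_def sum.distrib sum_subtractf sum_distrib_left)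
      finally show ?thesis
        by simp
    qed
    \<comment> \<open>The optimal step would be \<open>\<beta> / \<gamma>\<close>; adding 1 to the
      denominator covers \<open>\<gamma> = 0\<close> and still gives a contradiction unless
      \<open>\<beta> = 0\<close>.\<close>
    moreover define t where "t = \<beta> / (\<gamma> + 1)"
    moreover have \<beta>: "\<beta> = t * (\<gamma> + 1)"
      using \<gamma> by (simp add: t_def)
    ultimately have "2 * t * (t * (\<gamma> + 1)) \<le> t\<^sup>2 * \<gamma>"
      by metis
    then have "t\<^sup>2 * (\<gamma> + 2) \<le> 0"
      by (simp add: algebra_simps power2_eq_square)
    then have "\<beta> = 0"
      using \<gamma> by (simp add: mult_le_0_iff \<beta>)
    then show ?thesis
      by (simp add: \<beta>_def)
  qed
  have "(\<Sum>i\<in>I. cinner (f i - h i) (u i)) = 0" if u: "u \<in> L" for u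
  proof (rule complex_eqI)
    show "Re (\<Sum>i\<in>I. cinner (f i - h i) (u i)) = Re 0"
      using re[OF u] by (simp add: Re_cinner)
    \<comment> \<open>The minimization only controls real parts; testing against \<open>\<i>\<close>
      times the family yields the imaginary part.\<close>
    have "Im (cinner z v) = Re (cinner z (\<i> *\<^sub>C v))" for z v :: 'a
      by (simp add: cinner_scaleC_right)
    then show "Im (\<Sum>i\<in>I. cinner (f i - h i) (u i)) = Im 0"
      using re[OF scale[OF u, of "\<i>"]] by (simp add: Re_cinner)
  qed
  with hL show ?thesis
    by blast
qed

section \<open>Riesz representation and existence of adjoints\<close>

text \<open>The kernel of \<open>F\<close> is a closed subspace, treated as a direct sum with one
  summand indexed by \<open>unit\<close>. The part \<open>p\<close> of \<open>f\<close> orthogonal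
  to it represents \<open>F\<close> up to a factor, since \<open>z - (F z / F p) *\<^sub>C p\<close>
  lies in the kernel and is therefore orthogonal to \<open>p\<close>.\<close>

lemma riesz_representation:
  fixes F :: "'a::chilbert_space \<Rightarrow> complex"
  assumes F: "bounded_linear F" and FC: "\<And>c z. F (c *\<^sub>C z) = c * F z"
  shows "\<exists>w. \<forall>z. F z = cinner z w"
proof (cases "\<forall>z. F z = 0")
  case True
  then show ?thesis
    by (intro exI[of _ 0]) simp
next
  case False
  then obtain f where f: "F f \<noteq> 0"
    by blast
  interpret F: bounded_linear F
    by (rule F)
  have "\<exists>h\<in>{g :: unit \<Rightarrow> 'a. F (g ()) = 0}. \<forall>g\<in>{g. F (g ()) = 0}.
      (\<Sum>i\<in>UNIV. cinner (f - h i) (g i)) = 0"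
  proof (rule finite_sum_projection)
    fix g :: "nat \<Rightarrow> unit \<Rightarrow> 'a" and h
    assume *: "\<And>n::nat. g n \<in> {g. F (g ()) = 0}" "\<And>i. i \<in> UNIV \<Longrightarrow> (\<lambda>n. g n i) \<longlonglongrightarrow> h i"
    show "h \<in> {g. F (g ()) = 0}" 
      using LIMSEQ_unique[OF F.tendsto[OF *(2)]] *(1) by simp
  qed (auto simp: F.add FC F.zero)
  then obtain h' where h': "F (h' ()) = 0"
    "\<And>g. F (g ()) = 0 \<Longrightarrow> (\<Sum>i\<in>UNIV. cinner (f - h' i) (g i)) = 0"
    by blast
  define h where "h = h' ()"
  have h: "F h = 0" "\<And>g. F g = 0 \<Longrightarrow> cinner (f - h) g = 0"
    using h'(1) h'(2)[of "\<lambda>_. g" for g] by (simp_all add: h_def UNIV_unit)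
  define p where "p = f - h"
  have Fp: "F p \<noteq> 0"
    using f h by (simp add: p_def F.diff)
  then have p0: "cinner p p \<noteq> 0"
    using F.zero cinner_eq_zero_iff by metis
  have "F z = cinner z ((cnj (F p) / cinner p p) *\<^sub>C p)" for z
  proof -
    have "F (z - (F z / F p) *\<^sub>C p) = 0"
      using Fp by (simp add: F.diff FC)
    then have "cinner p (z - (F z / F p) *\<^sub>C p) = 0"
      using h(2) by (simp add: p_def)
    then have "cinner (z - (F z / F p) *\<^sub>C p) p = 0"
      by (metis cinner_commute complex_cnj_zero)
    then have "cinner z p = F z / F p * cinner p p"
      by (simp add: cinner_diff_left cinner_scaleC_left)
    then show ?thesis
      using Fp p0 by (simp add: cinner_scaleC_right cinner_self)
  qed
  then show ?thesis
    by blast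
qed

text \<open>As \<open>adjoint_op\<close> is a definite description, its defining equation has to be
  earned: Riesz representation gives the values \<open>T y\<close>, evaluating at \<open>T y\<close>
  bounds them by \<open>norm A * norm y\<close>, and nondegeneracy of the inner product gives
  uniqueness.\<close>

lemma cinner_adjoint:
  fixes A :: "'a::chilbert_space \<Rightarrow>\<^sub>L 'a"
  assumes A: "A \<in> bounded_operators"
  shows "cinner (A u) v = cinner u (adjoint_op A v)"
proof -
  have AC: "A (c *\<^sub>C z) = c *\<^sub>C A z" for c z
    using A by (simp add: bounded_operators_def)
  have "\<exists>w. \<forall>z. cinner (A z) y = cinner z w" for y
  proof (rule riesz_representation)
    show "bounded_linear (\<lambda>z. cinner (A z) y)"
    proof (rule bounded_linear_intro)
      show "cinner (A (r *\<^sub>R z)) y = r *\<^sub>R cinner (A z) y" for r z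
        by (simp add: scaleC_of_real[symmetric] AC cinner_scaleC_left scaleR_conv_of_real)
      show "norm (cinner (A z) y) \<le> norm z * (norm A * norm y)" for z
        by (rule order.trans[OF norm_cinner_le])
          (use mult_right_mono[OF norm_blinfun[of A z], of "norm y"] in \<open>simp add: mult_ac\<close>)
    qed (simp add: blinfun.add_right cinner_add_left)
  qed (simp add: AC cinner_scaleC_left)
  then obtain T where T: "\<And>y z. cinner (A z) y = cinner z (T y)"
    by metis
  have "bounded_linear T"
  proof (rule bounded_linear_intro)
    show "T (y + z) = T y + T z" for y z
      by (rule cinner_right_eqI) (simp add: T[symmetric] cinner_add_right)
    show "T (r *\<^sub>R z) = r *\<^sub>R T z" for r z
      by (rule cinner_right_eqI)
        (simp add: T[symmetric] cinner_scaleC_right flip: scaleC_of_real)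
    show "norm (T y) \<le> norm y * norm A" for y
    proof (cases "T y = 0")
      case False
      have "(norm (T y))\<^sup>2 = cmod (cinner (A (T y)) y)"
        by (simp add: T cinner_self norm_power)
      also have "\<dots> \<le> norm (A (T y)) * norm y"
        by (rule norm_cinner_le)
      also have "\<dots> \<le> norm A * norm (T y) * norm y"
        by (intro mult_right_mono norm_blinfun) simp
      finally show ?thesis
        using False by (simp add: power2_eq_square mult_ac)
    qed simp
  qed
  then have ex: "\<forall>u v. cinner (A u) v = cinner u (Blinfun T v)"
    by (simp add: bounded_linear_Blinfun_apply T)
  have "\<forall>u v. cinner (A u) v = cinner u (adjoint_op A v)"
    unfolding adjoint_op_def
  proof (rule theI2[where a = "Blinfun T"])
    show "\<forall>u v. cinner (A u) v = cinner u (Blinfun T v)"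
      by (rule ex)
    fix S :: "'a \<Rightarrow>\<^sub>L 'a"
    assume "\<forall>u v. cinner (A u) v = cinner u (S v)"
    then show "S = Blinfun T"
      using ex by (intro blinfun_eqI cinner_right_eqI) metis
  qed
  then show ?thesis
    by blast
qed

lemma cinner_adjoint':
  fixes A :: "'a::chilbert_space \<Rightarrow>\<^sub>L 'a"
  assumes "A \<in> bounded_operators"
  shows "cinner (adjoint_op A u) v = cinner u (A v)"
  by (metis assms cinner_adjoint cinner_commute)

section \<open>Operators with complex coefficients\<close>

lemma bounded_operator_scaleC: "A \<in> bounded_operators \<Longrightarrow> blinfun_apply A (c *\<^sub>C z) = c *\<^sub>C blinfun_apply A z"
  by (simp add: bounded_operators_def)

lemma id_bounded_operator: "id_blinfun \<in> bounded_operators"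
  by (simp add: bounded_operators_def)

lemma compose_bounded_operator:
  "A \<in> bounded_operators \<Longrightarrow> B \<in> bounded_operators \<Longrightarrow> A o\<^sub>L B \<in> bounded_operators"
  by (simp add: bounded_operators_def)

lemma adjoint_bounded_operator:
  assumes "A \<in> bounded_operators"
  shows "adjoint_op A \<in> bounded_operators"
  unfolding bounded_operators_def
proof (intro CollectI allI)
  fix c z
  show "adjoint_op A (c *\<^sub>C z) = c *\<^sub>C adjoint_op A z"
    by (rule cinner_right_eqI) (simp add: cinner_adjoint[OF assms, symmetric] cinner_scaleC_right)
qed

lemma commutant_apply:
  assumes "T \<in> commutant S" "A \<in> S"
  shows "T (A z) = A (T z)"
proof -
  have "T o\<^sub>L A = A o\<^sub>L T"
    using assms by (auto simp: commutant_def)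
  from arg_cong[OF this, of "\<lambda>X. X z"] show ?thesis
    by simp
qed

lemma commutantI:
  fixes S :: "('a::chilbert_space \<Rightarrow>\<^sub>L 'a) set"
  assumes "T \<in> bounded_operators" "\<And>A z. A \<in> S \<Longrightarrow> T (A z) = A (T z)"
  shows "T \<in> commutant S"
  using assms by (auto simp: commutant_def intro: blinfun_eqI)

lemma commutant_bounded: "T \<in> commutant S \<Longrightarrow> T \<in> bounded_operators"
  by (simp add: commutant_def)

lemma id_in_commutant: "id_blinfun \<in> commutant S"
  by (rule commutantI) (simp_all add: id_bounded_operator)

lemma compose_in_commutant: "T \<in> commutant S \<Longrightarrow> U \<in> commutant S \<Longrightarrow> T o\<^sub>L U \<in> commutant S"
  by (rule commutantI) (simp_all add: compose_bounded_operator commutant_bounded commutant_apply)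

lemma adjoint_in_commutant:
  assumes S: "S \<subseteq> bounded_operators" "\<And>A. A \<in> S \<Longrightarrow> adjoint_op A \<in> S" and T: "T \<in> commutant S"
  shows "adjoint_op T \<in> commutant S"
proof (rule commutantI)
  show "adjoint_op T \<in> bounded_operators"
    using T by (intro adjoint_bounded_operator commutant_bounded)
  fix A z
  assume A: "A \<in> S"
  then have A': "A \<in> bounded_operators"
    using S(1) by blast
  note adj = cinner_adjoint[OF commutant_bounded[OF T], symmetric]
    cinner_adjoint[OF A', symmetric] cinner_adjoint'[OF A', symmetric]
  show "adjoint_op T (A z) = A (adjoint_op T z)"
    by (rule cinner_right_eqI) (simp add: adj commutant_apply[OF T S(2)[OF A]])
qed

lemma bounded_linear_scaleC: "bounded_linear (\<lambda>z::'a::complex_inner. c *\<^sub>C z)"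
  by (rule bounded_linear_intro[where K = "cmod c"])
    (simp_all add: scaleC_add_right scaleC_scaleR norm_scaleC mult.commute)

text \<open>The operator type has real scalars only, so a complex combination is specified by its
  values. With \<open>S\<close> the commutant of a von Neumann algebra, the combination stays in the
  algebra.\<close>

lemma complex_combination_in_commutant:
  fixes A :: "'i \<Rightarrow> 'a::chilbert_space \<Rightarrow>\<^sub>L 'a"
  assumes A: "\<And>i. i \<in> I \<Longrightarrow> A i \<in> commutant S" and S: "S \<subseteq> bounded_operators"
  shows "\<exists>W\<in>commutant S. \<forall>z. W z = (\<Sum>i\<in>I. c i *\<^sub>C A i z)"
proof -
  have "bounded_linear (\<lambda>z. \<Sum>i\<in>I. c i *\<^sub>C A i z)"
    by (intro bounded_linear_sum bounded_linear_compose[OF bounded_linear_scaleC]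
        blinfun.bounded_linear_right)
  then have W: "Blinfun (\<lambda>z. \<Sum>i\<in>I. c i *\<^sub>C A i z) z = (\<Sum>i\<in>I. c i *\<^sub>C A i z)" for z
    by (simp add: bounded_linear_Blinfun_apply)
  have "Blinfun (\<lambda>z. \<Sum>i\<in>I. c i *\<^sub>C A i z) \<in> commutant S"
  proof (rule commutantI)
    show "Blinfun (\<lambda>z. \<Sum>i\<in>I. c i *\<^sub>C A i z) \<in> bounded_operators"
      using A by (auto simp: bounded_operators_def[of] W scaleC_sum_right scaleC_scaleC mult.commute
          bounded_operator_scaleC[OF commutant_bounded[OF A]] intro!: sum.cong)
    fix B z
    assume B: "B \<in> S"
    with S have "B \<in> bounded_operators"
      by blast
    then show "Blinfun (\<lambda>z. \<Sum>i\<in>I. c i *\<^sub>C A i z) (B z) = B (Blinfun (\<lambda>z. \<Sum>i\<in>I. c i *\<^sub>C A i z) z)"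
      unfolding W using A B
      by (auto simp: blinfun.sum_right bounded_operator_scaleC commutant_apply[OF A] intro!: sum.cong)
  qed
  with W show ?thesis
    by blast
qed

section \<open>Irreducible monoids of operators\<close>

text \<open>The matrix \<open>q\<close> represents the projection of the direct sum onto the annihilator of
  \<open>{(S b\<^sub>i)\<^sub>i | S \<in> G}\<close>: each of its entries commutes with \<open>G\<close>, hence is a scalar.\<close>

lemma irreducible_annihilator_projection:
  fixes G :: "('a::chilbert_space \<Rightarrow>\<^sub>L 'a) set" and b :: "'i \<Rightarrow> 'a"
  assumes I: "finite I" and GB: "G \<subseteq> bounded_operators"
    and G1: "id_blinfun \<in> G" and Gmult: "\<And>S T. S \<in> G \<Longrightarrow> T \<in> G \<Longrightarrow> S o\<^sub>L T \<in> G"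
    and Gadj: "\<And>S. S \<in> G \<Longrightarrow> adjoint_op S \<in> G"
    and irr: "commutant G \<subseteq> scalar_operators"
  obtains q where "\<And>i. i \<in> I \<Longrightarrow> (\<Sum>j\<in>I. q i j *\<^sub>C b j) = 0"
    and "\<And>a i. (\<And>S. S \<in> G \<Longrightarrow> (\<Sum>i\<in>I. cinner (blinfun_apply S (b i)) (a i)) = 0) \<Longrightarrow> i \<in> I \<Longrightarrow>
      (\<Sum>j\<in>I. q i j *\<^sub>C a j) = a i"
    and "\<And>i j (z::'a). i \<in> I \<Longrightarrow> j \<in> I \<Longrightarrow> cnj (q i j) *\<^sub>C z = q j i *\<^sub>C z"
proof -
  define L where "L = {g :: 'i \<Rightarrow> 'a. \<forall>S\<in>G. (\<Sum>i\<in>I. cinner (S (b i)) (g i)) = 0}"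
  have L0: "(\<lambda>i. 0) \<in> L"
    by (simp add: L_def)
  have Ladd: "(\<lambda>i. g i + h i) \<in> L" if "g \<in> L" "h \<in> L" for g h
    using that by (simp add: L_def cinner_add_right sum.distrib)
  have Lscale: "(\<lambda>i. c *\<^sub>C g i) \<in> L" if "g \<in> L" for c g
    using that by (simp add: L_def cinner_scaleC_right flip: sum_distrib_left)
  have LG: "(\<lambda>i. S (g i)) \<in> L" if "g \<in> L" "S \<in> G" for S g
  proof -
    have "(\<Sum>i\<in>I. cinner (T (b i)) (S (g i))) = 0" if "T \<in> G" for T
    proof -
      have "adjoint_op S o\<^sub>L T \<in> G"
        using \<open>S \<in> G\<close> \<open>T \<in> G\<close> by (intro Gmult Gadj)
      then have "(\<Sum>i\<in>I. cinner ((adjoint_op S o\<^sub>L T) (b i)) (g i)) = 0"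
        using \<open>g \<in> L\<close> unfolding L_def by blast
      moreover have "S \<in> bounded_operators"
        using \<open>S \<in> G\<close> GB by blast
      ultimately show ?thesis
        by (simp add: cinner_adjoint')
    qed
    then show ?thesis
      by (simp add: L_def)
  qed
  have "\<exists>h\<in>L. \<forall>g\<in>L. (\<Sum>i\<in>I. cinner (f i - h i) (g i)) = 0" for f
  proof (rule finite_sum_projection[OF I L0 Ladd Lscale])
    fix g :: "nat \<Rightarrow> 'i \<Rightarrow> 'a" and h
    assume g: "\<And>n. g n \<in> L" and lim: "\<And>i. i \<in> I \<Longrightarrow> (\<lambda>n. g n i) \<longlonglongrightarrow> h i"
    have "(\<Sum>i\<in>I. cinner (S (b i)) (h i)) = 0" if "S \<in> G" for S
    proof (rule LIMSEQ_unique)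
      show "(\<lambda>n. \<Sum>i\<in>I. cinner (S (b i)) (g n i)) \<longlonglongrightarrow> (\<Sum>i\<in>I. cinner (S (b i)) (h i))"
        by (intro tendsto_sum bounded_linear.tendsto[OF bounded_linear_cinner_right] lim)
      show "(\<lambda>n. \<Sum>i\<in>I. cinner (S (b i)) (g n i)) \<longlonglongrightarrow> 0"
        using g that by (simp add: L_def)
    qed
    then show "h \<in> L"
      by (simp add: L_def)
  qed
  then obtain Q where QL: "\<And>f. Q f \<in> L"
    and Qorth: "\<And>f g. g \<in> L \<Longrightarrow> (\<Sum>i\<in>I. cinner (f i - Q f i) (g i)) = 0"
    by metis
  \<comment> \<open>Linearity of \<open>Q\<close>, its compatibility with \<open>G\<close> and its
    values on \<open>L\<close> and on \<open>b\<close> are all read off from this uniqueness, which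
    speaks of indices in \<open>I\<close> only.\<close>
  have Quniq: "Q f i = h i" if "h \<in> L" "\<And>g. g \<in> L \<Longrightarrow> (\<Sum>i\<in>I. cinner (f i - h i) (g i)) = 0" "i \<in> I"
    for f h i
  proof -
    have d: "(\<lambda>i. Q f i - h i) \<in> L"
      using Ladd[OF QL Lscale[OF that(1), of "-1"]] by (simp add: scaleC_minus_left)
    have "(\<Sum>i\<in>I. cinner (Q f i - h i) (Q f i - h i)) =
        (\<Sum>i\<in>I. cinner (f i - h i) (Q f i - h i)) - (\<Sum>i\<in>I. cinner (f i - Q f i) (Q f i - h i))"
      by (simp add: cinner_diff_left sum_subtractf)
    also have "\<dots> = 0"
      using that(2)[OF d] Qorth[OF d] by simp
    finally have "complex_of_real (\<Sum>i\<in>I. (norm (Q f i - h i))\<^sup>2) = 0"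
      by (simp add: cinner_self)
    then have "(\<Sum>i\<in>I. (norm (Q f i - h i))\<^sup>2) = 0"
      by (simp only: of_real_eq_0_iff)
    then show ?thesis
      using I that(3) by (simp add: sum_nonneg_eq_0_iff)
  qed
  have Qadd: "Q (\<lambda>i. f i + g i) i = Q f i + Q g i" if "i \<in> I" for f g i
  proof (rule Quniq[OF _ _ that])
    show "(\<lambda>i. Q f i + Q g i) \<in> L"
      by (intro Ladd QL)
    fix u assume "u \<in> L"
    have "(\<Sum>i\<in>I. cinner (f i + g i - (Q f i + Q g i)) (u i)) =
        (\<Sum>i\<in>I. cinner (f i - Q f i) (u i)) + (\<Sum>i\<in>I. cinner (g i - Q g i) (u i))"
      by (simp add: cinner_diff_left cinner_add_left sum.distrib sum_subtractf)
    then show "(\<Sum>i\<in>I. cinner (f i + g i - (Q f i + Q g i)) (u i)) = 0"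
      using Qorth[OF \<open>u \<in> L\<close>] by simp
  qed
  have Qscale: "Q (\<lambda>i. c *\<^sub>C f i) i = c *\<^sub>C Q f i" if "i \<in> I" for c f i
  proof (rule Quniq[OF _ _ that])
    show "(\<lambda>i. c *\<^sub>C Q f i) \<in> L"
      by (intro Lscale QL)
    fix u assume "u \<in> L"
    then show "(\<Sum>i\<in>I. cinner (c *\<^sub>C f i - c *\<^sub>C Q f i) (u i)) = 0"
      by (simp add: cinner_scaleC_left Qorth flip: scaleC_diff_right sum_distrib_left)
  qed
  \<comment> \<open>Closure of \<open>G\<close> under adjoints makes the orthogonal complement of
    \<open>L\<close> invariant as well as \<open>L\<close>, so the projection commutes with
    \<open>G\<close> acting diagonally.\<close>
  have QG: "Q (\<lambda>i. S (f i)) i = S (Q f i)" if "i \<in> I" "S \<in> G" for S f i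
  proof (rule Quniq[OF _ _ that(1)])
    show "(\<lambda>i. S (Q f i)) \<in> L"
      using that by (intro LG QL)
    fix u assume "u \<in> L"
    then have "(\<lambda>i. adjoint_op S (u i)) \<in> L"
      using that by (intro LG Gadj)
    moreover have "S \<in> bounded_operators"
      using that GB by blast
    ultimately show "(\<Sum>i\<in>I. cinner (S (f i) - S (Q f i)) (u i)) = 0"
      using Qorth by (simp add: cinner_adjoint flip: blinfun.diff_right)
  qed
  have Qid: "Q a i = a i" if "a \<in> L" "i \<in> I" for a i
    by (rule Quniq) (use that in simp_all)
  have Qb: "Q b i = 0" if "i \<in> I" for i
  proof (rule Quniq[OF L0 _ that])
    fix g assume "g \<in> L"
    then have "(\<Sum>i\<in>I. cinner (id_blinfun (b i)) (g i)) = 0"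
      using G1 unfolding L_def by blast
    then show "(\<Sum>i\<in>I. cinner (b i - 0) (g i)) = 0"
      by simp
  qed
  have Qself: "(\<Sum>i\<in>I. cinner (Q f i) (g i)) = (\<Sum>i\<in>I. cinner (f i) (Q g i))" for f g
  proof -
    have 1: "(\<Sum>i\<in>I. cinner (f i) (Q g i)) = (\<Sum>i\<in>I. cinner (Q f i) (Q g i))"
      using Qorth[OF QL, of f g] by (simp add: cinner_diff_left sum_subtractf)
    have "cnj (\<Sum>i\<in>I. cinner (g i - Q g i) (Q f i)) = 0"
      using Qorth[OF QL] by simp
    then have "(\<Sum>i\<in>I. cinner (Q f i) (g i - Q g i)) = 0"
      by (simp add: cinner_commute[symmetric])
    then show ?thesis
      using 1 by (simp add: cinner_diff_right sum_subtractf)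
  qed
  \<comment> \<open>A matrix entry must be a bounded operator before irreducibility can be applied
    to it. The bound comes from \<open>f - Q f\<close> being orthogonal to \<open>Q f\<close>,
    followed by the arithmetic-geometric mean inequality.\<close>
  have Qnorm: "norm (Q f i) \<le> (\<Sum>i\<in>I. norm (f i))" if "i \<in> I" for f i
  proof -
    have "complex_of_real (\<Sum>i\<in>I. (norm (Q f i))\<^sup>2) = (\<Sum>i\<in>I. cinner (f i) (Q f i))"
      using Qorth[OF QL, of f f] by (simp add: cinner_diff_left sum_subtractf cinner_self)
    then have "(\<Sum>i\<in>I. (norm (Q f i))\<^sup>2) = (\<Sum>i\<in>I. inner (f i) (Q f i))"
      by (auto simp: Re_cinner dest: arg_cong[of _ _ Re])
    also have "\<dots> \<le> (\<Sum>i\<in>I. norm (f i) * norm (Q f i))"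
      by (intro sum_mono norm_cauchy_schwarz)
    finally have 1: "(\<Sum>i\<in>I. (norm (Q f i))\<^sup>2) \<le> (\<Sum>i\<in>I. norm (f i) * norm (Q f i))" .
    have "(\<Sum>i\<in>I. (norm (Q f i))\<^sup>2) \<le> (\<Sum>i\<in>I. (norm (f i))\<^sup>2)"
    proof -
      have "norm (f i) * norm (Q f i) \<le> ((norm (f i))\<^sup>2 + (norm (Q f i))\<^sup>2) / 2" for i
        using sum_squares_bound[of "norm (f i)" "norm (Q f i)"] by simp
      then have "(\<Sum>i\<in>I. norm (f i) * norm (Q f i)) \<le> (\<Sum>i\<in>I. ((norm (f i))\<^sup>2 + (norm (Q f i))\<^sup>2) / 2)"
        by (intro sum_mono)
      then show ?thesis
        using 1 by (simp add: sum.distrib flip: sum_divide_distrib)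
    qed
    moreover have "(norm (Q f i))\<^sup>2 \<le> (\<Sum>i\<in>I. (norm (Q f i))\<^sup>2)"
      using I that by (intro member_le_sum) auto
    ultimately have "norm (Q f i) \<le> L2_set (\<lambda>i. norm (f i)) I"
      unfolding L2_set_def by (intro real_le_rsqrt) linarith
    also have "\<dots> \<le> (\<Sum>i\<in>I. norm (f i))"
      by (intro L2_set_le_sum) simp
    finally show ?thesis .
  qed
  \<comment> \<open>The embedding of the space as summand \<open>j\<close>; the map sending
    \<open>z\<close> to \<open>Q (e j z) i\<close> is then entry \<open>(i, j)\<close> of the matrix
    of \<open>Q\<close>.\<close>
  define e where "e = (\<lambda>j (z::'a) (i::'i). if i = j then z else 0)"
  have "\<exists>c. \<forall>z. Q (e j z) i = c *\<^sub>C z" if ij: "i \<in> I" "j \<in> I" for i j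
  proof -
    have eS: "e j (S z) = (\<lambda>i. S (e j z i))" if "S 0 = 0" for S z
      using that by (auto simp: e_def)
    have bl: "bounded_linear (\<lambda>z. Q (e j z) i)"
    proof (rule bounded_linear_intro)
      show "Q (e j (y + z)) i = Q (e j y) i + Q (e j z) i" for y z
      proof -
        have "e j (y + z) = (\<lambda>i. e j y i + e j z i)"
          by (auto simp: e_def)
        then show ?thesis
          by (simp add: Qadd[OF ij(1)])
      qed
      show "Q (e j (r *\<^sub>R z)) i = r *\<^sub>R Q (e j z) i" for r z
        using Qscale[OF ij(1), of "of_real r" "e j z"] eS[of "\<lambda>z. r *\<^sub>R z"]
        by (simp add: scaleC_of_real)
      show "norm (Q (e j z) i) \<le> norm z * 1" for z
        using Qnorm[OF ij(1), of "e j z"] I ij by (simp add: e_def if_distrib sum.delta cong: if_cong)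
    qed
    define T where "T = Blinfun (\<lambda>z. Q (e j z) i)"
    have T: "T z = Q (e j z) i" for z
      by (simp add: T_def bounded_linear_Blinfun_apply[OF bl])
    have "T \<in> commutant G"
    proof (rule commutantI)
      show "T \<in> bounded_operators"
        using Qscale[OF ij(1)] eS[of "\<lambda>z. c *\<^sub>C z" for c] by (simp add: bounded_operators_def T)
      show "T (S z) = S (T z)" if "S \<in> G" for S z
        using QG[OF ij(1) that] eS[of S] by (simp add: T)
    qed
    then show ?thesis
      using irr unfolding scalar_operators_def T[symmetric] by blast
  qed
  then obtain q where q: "\<And>i j z. i \<in> I \<Longrightarrow> j \<in> I \<Longrightarrow> Q (e j z) i = q i j *\<^sub>C z"
    by metis
  have Qsum: "Q (\<lambda>i. \<Sum>j\<in>J. g j i) i = (\<Sum>j\<in>J. Q (g j) i)" if "finite J" "i \<in> I" for J :: "'i set" and g i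
    using that(1)
  proof induction
    case empty
    show ?case
      using Qid[OF L0 that(2)] by simp
  qed (simp add: Qadd[OF that(2)])
  have Qcong: "Q f i = Q g i" if "i \<in> I" "\<And>i. i \<in> I \<Longrightarrow> f i = g i" for f g i
  proof (rule Quniq[OF QL _ that(1)])
    fix u assume u: "u \<in> L"
    have "(\<Sum>i\<in>I. cinner (f i - Q g i) (u i)) = (\<Sum>i\<in>I. cinner (g i - Q g i) (u i))"
      by (intro sum.cong) (simp_all add: that(2))
    then show "(\<Sum>i\<in>I. cinner (f i - Q g i) (u i)) = 0"
      using Qorth[OF u] by simp
  qed
  have Qq: "Q f i = (\<Sum>j\<in>I. q i j *\<^sub>C f j)" if "i \<in> I" for f i
  proof -
    have "Q f i = Q (\<lambda>i. \<Sum>j\<in>I. e j (f j) i) i"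
      using I that by (intro Qcong) (simp_all add: e_def)
    also have "\<dots> = (\<Sum>j\<in>I. q i j *\<^sub>C f j)"
      using that q by (simp add: Qsum[OF I])
    finally show ?thesis .
  qed
  \<comment> \<open>Hermitian symmetry is stated on vectors because the scalars \<open>q i j\<close>
    are not determined if the space is zero.\<close>
  have qq: "cnj (q i j) *\<^sub>C z = q j i *\<^sub>C z" if "i \<in> I" "j \<in> I" for i j and z :: 'a
  proof (rule cinner_left_eqI)
    fix w
    have "(\<Sum>k\<in>I. cinner (Q (e i z) k) (e j w k)) = (\<Sum>k\<in>I. cinner (e i z k) (Q (e j w) k))"
      by (rule Qself)
    then have "cinner (Q (e i z) j) w = cinner z (Q (e j w) i)"
      using I that by (simp add: e_def if_distrib[of "cinner _"] if_distrib[of "\<lambda>z. cinner z _"] cong: if_cong)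
    then show "cinner (cnj (q i j) *\<^sub>C z) w = cinner (q j i *\<^sub>C z) w"
      using that by (auto simp: q cinner_scaleC_left cinner_scaleC_right)
  qed
  have qb: "(\<Sum>j\<in>I. q i j *\<^sub>C b j) = 0" if "i \<in> I" for i
    using Qq[OF that, of b] Qb[OF that] by simp
  have qa: "(\<Sum>j\<in>I. q i j *\<^sub>C a j) = a i"
    if "\<And>S. S \<in> G \<Longrightarrow> (\<Sum>i\<in>I. cinner (S (b i)) (a i)) = 0" "i \<in> I" for a i
  proof -
    have "a \<in> L"
      using that(1) by (simp add: L_def)
    then show ?thesis
      using Qq[OF that(2), of a] Qid that(2) by simp
  qed
  show ?thesis
    by (rule that[OF qb qa qq])
qed

text \<open>The hypothesis couples \<open>b i\<close> and \<open>a i\<close> in one inner product,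
  while the conclusion tests them against independent vectors. Replacing \<open>a\<close> by its
  image under \<open>q\<close> and carrying the matrix across to \<open>b\<close> by hermitian
  symmetry produces combinations of \<open>b\<close> that vanish.\<close>

lemma irreducible_annihilates_tensor:
  fixes G :: "('a::chilbert_space \<Rightarrow>\<^sub>L 'a) set" and a b :: "'i \<Rightarrow> 'a"
  assumes I: "finite I" and GB: "G \<subseteq> bounded_operators"
    and G1: "id_blinfun \<in> G" and Gmult: "\<And>S T. S \<in> G \<Longrightarrow> T \<in> G \<Longrightarrow> S o\<^sub>L T \<in> G"
    and Gadj: "\<And>S. S \<in> G \<Longrightarrow> adjoint_op S \<in> G"
    and irr: "commutant G \<subseteq> scalar_operators"
    and ann: "\<And>S. S \<in> G \<Longrightarrow> (\<Sum>i\<in>I. cinner (blinfun_apply S (b i)) (a i)) = 0"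
  shows "(\<Sum>i\<in>I. cinner (b i) v * cinner u (a i)) = 0"
proof -
  obtain q where qb: "\<And>i. i \<in> I \<Longrightarrow> (\<Sum>j\<in>I. q i j *\<^sub>C b j) = 0"
    and q: "\<And>a i. (\<And>S. S \<in> G \<Longrightarrow> (\<Sum>i\<in>I. cinner (blinfun_apply S (b i)) (a i)) = 0) \<Longrightarrow> i \<in> I \<Longrightarrow>
      (\<Sum>j\<in>I. q i j *\<^sub>C a j) = a i"
    and qq: "\<And>i j (z::'a). i \<in> I \<Longrightarrow> j \<in> I \<Longrightarrow> cnj (q i j) *\<^sub>C z = q j i *\<^sub>C z"
  proof (rule irreducible_annihilator_projection[where b = b, OF I GB G1 _ _ irr], goal_cases)
    case (3 q)
    show ?case
      by (rule that[OF 3(2-4)])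
  qed (simp_all add: Gmult Gadj)
  note qa = q[OF ann]
  have "(\<Sum>i\<in>I. cinner (b i) v * cinner u (a i)) =
      (\<Sum>i\<in>I. cinner (b i) v * cinner u (\<Sum>j\<in>I. q i j *\<^sub>C a j))"
    by (simp add: qa)
  also have "\<dots> = (\<Sum>i\<in>I. \<Sum>j\<in>I. cinner (cnj (q i j) *\<^sub>C b i) v * cinner u (a j))"
    by (simp add: cinner_sum_right sum_distrib_left cinner_scaleC_right cinner_scaleC_left mult_ac)
  also have "\<dots> = (\<Sum>j\<in>I. \<Sum>i\<in>I. cinner (cnj (q i j) *\<^sub>C b i) v * cinner u (a j))"
    by (rule sum.swap)
  also have "\<dots> = (\<Sum>j\<in>I. cinner (\<Sum>i\<in>I. q j i *\<^sub>C b i) v * cinner u (a j))"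
    by (simp add: qq cinner_sum_left sum_distrib_right)
  also have "\<dots> = 0"
    by (simp add: qb)
  finally show ?thesis .
qed

section \<open>Elementary operators on a factor\<close>

text \<open>Irreducibility is applied to \<open>b i = B i z\<close> and
  \<open>a i = adjoint_op (A i) w\<close>. An operator commuting with all products
  \<open>C o\<^sub>L T\<close> commutes with M (take \<open>T\<close> the identity) and with its
  commutant (take \<open>C\<close> the identity), hence is central.\<close>

lemma factor_elementary_operator_zero:
  fixes M :: "('a::chilbert_space \<Rightarrow>\<^sub>L 'a) set"
  assumes M: "factor M" and I: "finite I"
    and A: "\<And>i. i \<in> I \<Longrightarrow> A i \<in> M" and B: "\<And>i. i \<in> I \<Longrightarrow> B i \<in> M"
    and zero: "\<And>C. C \<in> M \<Longrightarrow> (\<Sum>i\<in>I. A i o\<^sub>L C o\<^sub>L B i) = 0"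
  shows "(\<Sum>i\<in>I. cinner (blinfun_apply (B i) z) v * cinner (blinfun_apply (A i) u) w) = 0"
proof -
  define N where "N = commutant M"
  have vN: "M \<subseteq> bounded_operators" "\<And>C. C \<in> M \<Longrightarrow> adjoint_op C \<in> M" "commutant N = M"
    and center: "M \<inter> N = scalar_operators"
    using M by (auto simp: factor_def von_neumann_algebra_def N_def)
  have N1: "id_blinfun \<in> N" and NB: "N \<subseteq> bounded_operators"
    by (auto simp: N_def id_in_commutant dest: commutant_bounded)
  have M1: "id_blinfun \<in> M"
    using id_in_commutant[of N] vN by simp
  have comm: "T (C y) = C (T y)" if "C \<in> M" "T \<in> N" for C T y
    using that commutant_apply unfolding N_def by blast
  have Mmult: "C o\<^sub>L C' \<in> M" if "C \<in> M" "C' \<in> M" for C C'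
    using compose_in_commutant[of C N C'] that vN by simp
  have Nmult: "T o\<^sub>L T' \<in> N" if "T \<in> N" "T' \<in> N" for T T'
    using that by (simp add: N_def compose_in_commutant)
  have Nadj: "adjoint_op T \<in> N" if "T \<in> N" for T
    using adjoint_in_commutant[OF vN(1,2)] that by (simp add: N_def)
  define G where "G = {C o\<^sub>L T | C T. C \<in> M \<and> T \<in> N}"
  have A': "A i \<in> bounded_operators" if "i \<in> I" for i
    using A[OF that] vN(1) by blast
  have "(\<Sum>i\<in>I. cinner (B i z) v * cinner u (adjoint_op (A i) w)) = 0"
  proof (rule irreducible_annihilates_tensor[where G = G, OF I])
    show "G \<subseteq> bounded_operators"
      using vN(1) NB by (auto simp: G_def intro!: compose_bounded_operator)
    show "id_blinfun \<in> G"
      using M1 N1 by (auto simp: G_def intro!: exI[of _ id_blinfun] blinfun_eqI)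
    show "S o\<^sub>L S' \<in> G" if S: "S \<in> G" "S' \<in> G" for S S'
    proof -
      obtain C T C' T' where *: "S = C o\<^sub>L T" "S' = C' o\<^sub>L T'" "C \<in> M" "T \<in> N" "C' \<in> M" "T' \<in> N"
        using S by (auto simp: G_def)
      then have "S o\<^sub>L S' = (C o\<^sub>L C') o\<^sub>L (T o\<^sub>L T')"
        by (intro blinfun_eqI) (simp add: comm)
      then show ?thesis
        using * Mmult Nmult unfolding G_def by blast
    qed
    show "adjoint_op S \<in> G" if S: "S \<in> G" for S
    proof -
      obtain C T where *: "S = C o\<^sub>L T" "C \<in> M" "T \<in> N"
        using S by (auto simp: G_def)
      then have bdd: "C \<in> bounded_operators" "T \<in> bounded_operators" "S \<in> bounded_operators"
        using vN(1) NB by (auto intro!: compose_bounded_operator)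
      have "adjoint_op S y = (adjoint_op C o\<^sub>L adjoint_op T) y" for y
        by (rule cinner_right_eqI)
          (simp add: bdd * comm compose_bounded_operator flip: cinner_adjoint)
      then have "adjoint_op S = adjoint_op C o\<^sub>L adjoint_op T"
        by (rule blinfun_eqI)
      then show ?thesis
        using * vN(2) Nadj unfolding G_def by blast
    qed
    show "commutant G \<subseteq> scalar_operators"
    proof
      fix X
      assume X: "X \<in> commutant G"
      have "C o\<^sub>L id_blinfun \<in> G" if "C \<in> M" for C
        using that N1 unfolding G_def by blast
      then have "X \<in> N"
        unfolding N_def using commutant_apply[OF X]
        by (intro commutantI commutant_bounded[OF X]) fastforce
      have "id_blinfun o\<^sub>L T \<in> G" if "T \<in> N" for T
        using that M1 unfolding G_def by blast
      then have "X \<in> commutant N"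
        using commutant_apply[OF X]
        by (intro commutantI commutant_bounded[OF X]) fastforce
      with \<open>X \<in> N\<close> show "X \<in> scalar_operators"
        using vN(3) center by blast
    qed
    show "(\<Sum>i\<in>I. cinner (S (B i z)) (adjoint_op (A i) w)) = 0" if "S \<in> G" for S
    proof -
      obtain C T where *: "S = C o\<^sub>L T" "C \<in> M" "T \<in> N"
        using \<open>S \<in> G\<close> by (auto simp: G_def)
      \<comment> \<open>Since \<open>T\<close> commutes with every \<open>B i\<close>, it can be
        moved onto \<open>z\<close>, leaving the elementary operator at \<open>C\<close>, which is
        zero by hypothesis.\<close>
      have "(\<Sum>i\<in>I. cinner (S (B i z)) (adjoint_op (A i) w)) = cinner ((\<Sum>i\<in>I. A i o\<^sub>L C o\<^sub>L B i) (T z)) w"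
        using A' *(1) by (simp add: blinfun.sum_left cinner_sum_left comm[OF B *(3)] cinner_adjoint[symmetric])
      then show ?thesis
        using zero[OF *(2)] by simp
    qed
  qed
  then show ?thesis
    using A' by (simp add: cinner_adjoint[symmetric])
qed

text \<open>A vanishing tensor has vanishing contraction. If \<open>b j\<close> is nonzero, testing
  with \<open>v = b j\<close> expresses \<open>A j\<close> through the other operators; replacing
  each remaining \<open>b i\<close> by its component orthogonal to \<open>b j\<close> then gives a
  shorter vanishing tensor.\<close>

lemma elementary_sum_zero_of_pairing_zero:
  fixes A :: "'i \<Rightarrow> 'a::chilbert_space \<Rightarrow>\<^sub>L 'a"
  assumes "finite I" and "\<And>i. i \<in> I \<Longrightarrow> A i \<in> bounded_operators"
    and "\<And>u v. (\<Sum>i\<in>I. cinner (b i) v *\<^sub>C blinfun_apply (A i) u) = 0"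
  shows "(\<Sum>i\<in>I. blinfun_apply (A i) (b i)) = 0"
  using assms
proof (induction I arbitrary: b rule: finite_induct)
  case (insert j F)
  note zero = insert.prems(2)
  have AF: "A i \<in> bounded_operators" if "i \<in> F" for i
    using insert.prems(1) that by blast
  show ?case
  proof (cases "b j = 0")
    case True
    then have "(\<Sum>i\<in>F. cinner (b i) v *\<^sub>C A i u) = 0" for u v
      using zero[of v u] insert.hyps by simp
    then show ?thesis
      using insert.IH[OF AF] insert.hyps True by simp
  next
    case False
    define c where "c i = cinner (b i) (b j) / cinner (b j) (b j)" for i
    have c1: "c j = 1"
      using False by (simp add: c_def cinner_eq_zero_iff)
    have Aj: "A j u = - (\<Sum>i\<in>F. c i *\<^sub>C A i u)" for u
    proof -
      have "(1 / cinner (b j) (b j)) *\<^sub>C (\<Sum>i\<in>insert j F. cinner (b i) (b j) *\<^sub>C A i u) = 0"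
        by (simp only: zero scaleC_zero_right)
      then have "(\<Sum>i\<in>insert j F. c i *\<^sub>C A i u) = 0"
        by (simp only: scaleC_sum_right scaleC_scaleC c_def) simp
      then show ?thesis
        using insert.hyps c1 by (simp add: eq_neg_iff_add_eq_0)
    qed
    have "(\<Sum>i\<in>F. cinner (b i - c i *\<^sub>C b j) v *\<^sub>C A i u) = 0" for u v
    proof -
      have "(\<Sum>i\<in>F. cinner (b i - c i *\<^sub>C b j) v *\<^sub>C A i u)
          = (\<Sum>i\<in>F. cinner (b i) v *\<^sub>C A i u) - cinner (b j) v *\<^sub>C (\<Sum>i\<in>F. c i *\<^sub>C A i u)"
        by (simp add: cinner_diff_left cinner_scaleC_left scaleC_sum_right scaleC_scaleC mult.commute
            scaleC_add_left scaleC_minus_left sum_subtractf sum.distrib sum_negf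
            diff_conv_add_uminus[of "cinner _ _"] del: diff_conv_add_uminus add_uminus_conv_diff)
      also have "\<dots> = (\<Sum>i\<in>insert j F. cinner (b i) v *\<^sub>C A i u)"
        using insert.hyps by (simp add: Aj scaleC_minus_right)
      finally show ?thesis
        using zero by simp
    qed
    then have "(\<Sum>i\<in>F. A i (b i - c i *\<^sub>C b j)) = 0"
      by (intro insert.IH AF)
    then have "(\<Sum>i\<in>F. A i (b i)) = (\<Sum>i\<in>F. c i *\<^sub>C A i (b j))"
      by (simp add: blinfun.diff_right sum_subtractf bounded_operator_scaleC[OF AF])
    then show ?thesis
      using insert.hyps by (simp add: Aj)
  qed
qed simp

text \<open>The hypothesis contains \<open>x\<close> in two places, and the separating property
  frees them one at a time. A combination of the \<open>B i\<close> killing \<open>x\<close> is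
  zero, so \<open>B i x\<close> may become \<open>B i z\<close>; after passing to adjoints the same
  argument turns \<open>adjoint_op (A i) x\<close> into \<open>adjoint_op (A i) w\<close>.\<close>

lemma separating_elementary_operator_zero:
  fixes M :: "('a::chilbert_space \<Rightarrow>\<^sub>L 'a) set"
  assumes M: "von_neumann_algebra M" and sep: "separating_vector M x" and I: "finite I"
    and A: "\<And>i. i \<in> I \<Longrightarrow> A i \<in> M" and B: "\<And>i. i \<in> I \<Longrightarrow> B i \<in> M"
    and zero: "\<And>y. (\<Sum>i\<in>I. cinner (blinfun_apply (A i) y) x *\<^sub>C blinfun_apply (B i) x) = 0"
    and C: "C \<in> bounded_operators"
  shows "(\<Sum>i\<in>I. A i o\<^sub>L C o\<^sub>L B i) = 0"
proof -
  have vN: "M \<subseteq> bounded_operators" "\<And>C. C \<in> M \<Longrightarrow> adjoint_op C \<in> M" "commutant (commutant M) = M"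
    using M by (auto simp: von_neumann_algebra_def)
  have cM: "commutant M \<subseteq> bounded_operators"
    by (auto dest: commutant_bounded)
  have A': "A i \<in> bounded_operators" if "i \<in> I" for i
    using A[OF that] vN(1) by blast
  have combination_zero: "(\<Sum>i\<in>I. c i *\<^sub>C T i z) = 0"
    if T: "\<And>i. i \<in> I \<Longrightarrow> T i \<in> M" and "(\<Sum>i\<in>I. c i *\<^sub>C T i x) = 0" for c T z
  proof -
    obtain W where W: "W \<in> M" "\<And>z. W z = (\<Sum>i\<in>I. c i *\<^sub>C T i z)"
      using complex_combination_in_commutant[of I T "commutant M" c] T cM vN(3) by metis
    then have "W = 0"
      using sep that(2) by (simp add: separating_vector_def)
    with W(2)[of z] show ?thesis
      by simp
  qed
  have 1: "(\<Sum>i\<in>I. cinner (A i y) x *\<^sub>C B i z) = 0" for y z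
    by (rule combination_zero[OF B zero])
  have 2: "(\<Sum>i\<in>I. cinner v (B i z) *\<^sub>C adjoint_op (A i) x) = 0" for v z
  proof (rule cinner_right_eqI)
    fix y
    have "cinner (\<Sum>i\<in>I. cinner (A i y) x *\<^sub>C B i z) v = 0"
      by (simp add: 1)
    then show "cinner y (\<Sum>i\<in>I. cinner v (B i z) *\<^sub>C adjoint_op (A i) x) = cinner y 0"
      using A' by (simp add: cinner_sum_left cinner_sum_right cinner_scaleC_left cinner_scaleC_right
          cinner_commute[of _ v, symmetric] cinner_adjoint[symmetric] mult.commute)
  qed
  have 3: "(\<Sum>i\<in>I. cinner v (B i z) *\<^sub>C adjoint_op (A i) w) = 0" for v z w
    by (rule combination_zero[OF vN(2)[OF A] 2])
  have 4: "(\<Sum>i\<in>I. cinner (B i z) v *\<^sub>C A i u) = 0" for v z u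
  proof (rule cinner_left_eqI)
    fix w
    have "cinner u (\<Sum>i\<in>I. cinner v (B i z) *\<^sub>C adjoint_op (A i) w) = 0"
      by (simp add: 3)
    then show "cinner (\<Sum>i\<in>I. cinner (B i z) v *\<^sub>C A i u) w = cinner 0 w"
      using A' by (simp add: cinner_sum_left cinner_sum_right cinner_scaleC_left cinner_scaleC_right
          cinner_commute[of _ v, symmetric] cinner_adjoint[symmetric])
  qed
  show ?thesis
  proof (rule blinfun_eqI)
    fix z
    \<comment> \<open>The operator \<open>C\<close> is absorbed into the left factor; as the pairing
      vanishes at every \<open>u\<close>, it vanishes at \<open>C u\<close>.\<close>
    have "(\<Sum>i\<in>I. (A i o\<^sub>L C) (B i z)) = 0"
      by (rule elementary_sum_zero_of_pairing_zero[OF I])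
        (use A' C 4 in \<open>simp_all add: compose_bounded_operator\<close>)
    then show "(\<Sum>i\<in>I. A i o\<^sub>L C o\<^sub>L B i) z = blinfun_apply 0 z"
      by (simp add: blinfun.sum_left)
  qed
qed

section \<open>Positive operators of finite rank\<close>

text \<open>Evaluating the form at \<open>y + z\<close> and at \<open>y + \<i> *\<^sub>C z\<close>
  separates the two mixed terms. Reality of the form makes them conjugate; if the form is zero, the
  choice \<open>z = D y\<close> leaves \<open>cinner (D y) (D y) = 0\<close>.\<close>

lemma positive_form_polarization:
  fixes D :: "'a::complex_inner \<Rightarrow> 'a"
  assumes add: "\<And>y z. D (y + z) = D y + D z" and scale: "\<And>c z. D (c *\<^sub>C z) = c *\<^sub>C D z"
  shows positive_form_hermitian: "(\<And>y. cinner (D y) y \<in> \<real>\<^sub>\<ge>\<^sub>0) \<Longrightarrow> cinner y (D z) = cinner (D y) z"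
    and zero_form_zero: "(\<And>y. cinner (D y) y = 0) \<Longrightarrow> D y = 0"
proof -
  have pol1: "cinner (D (y + z)) (y + z) =
      cinner (D y) y + cinner (D y) z + cinner (D z) y + cinner (D z) z" for y z
    by (simp add: add cinner_add_left cinner_add_right)
  have pol2: "cinner (D (y + \<i> *\<^sub>C z)) (y + \<i> *\<^sub>C z) =
      cinner (D y) y - \<i> * cinner (D y) z + \<i> * cinner (D z) y + cinner (D z) z" for y z
    by (simp add: add scale cinner_add_left cinner_add_right cinner_scaleC_left cinner_scaleC_right
        ring_distribs)
  show "cinner y (D z) = cinner (D y) z" if pos: "\<And>y. cinner (D y) y \<in> \<real>\<^sub>\<ge>\<^sub>0"
  proof -
    have im: "Im (cinner (D u) u) = 0" for u
      using pos[of u] by (simp add: complex_nonneg_Reals_iff)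
    have "cinner (D y) z = cnj (cinner (D z) y)"
    proof (rule complex_eqI)
      show "Re (cinner (D y) z) = Re (cnj (cinner (D z) y))"
        using arg_cong[OF pol2[of y z], of Im] by (simp add: im)
      show "Im (cinner (D y) z) = Im (cnj (cinner (D z) y))"
        using arg_cong[OF pol1[of y z], of Im] by (simp add: im)
    qed
    then show ?thesis
      by (simp add: cinner_commute[symmetric])
  qed
  show "D y = 0" if zero: "\<And>y. cinner (D y) y = 0"
  proof -
    have "cinner (D y) (D y) + cinner (D (D y)) y = 0"
      using pol1[of y "D y"] by (simp add: zero)
    moreover have "cinner (D (D y)) y = cinner (D y) (D y)"
      using pol2[of y "D y"] by (simp add: zero)
    ultimately show ?thesis
      by (simp add: cinner_eq_zero_iff)
  qed
qed

text \<open>A Cholesky decomposition: subtracting from \<open>D\<close> the rank one operator of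
  \<open>D y / sqrt (cinner (D y) y)\<close> leaves a positive operator whose range is orthogonal to \<open>y\<close>,
  so that one of the spanning vectors can be eliminated.\<close>

lemma positive_finite_rank_decomposition:
  fixes D :: "'a::complex_inner \<Rightarrow> 'a" and X :: "'a set"
  assumes X_diff: "\<And>y z. y \<in> X \<Longrightarrow> z \<in> X \<Longrightarrow> y - z \<in> X"
    and X_scale: "\<And>c z. z \<in> X \<Longrightarrow> c *\<^sub>C z \<in> X"
    and D_X: "\<And>z. D z \<in> X"
    and "finite I" and "\<And>i. i \<in> I \<Longrightarrow> b i \<in> X"
    and "\<And>y z. D (y + z) = D y + D z" and "\<And>c z. D (c *\<^sub>C z) = c *\<^sub>C D z"
    and "\<And>y. cinner (D y) y \<in> \<real>\<^sub>\<ge>\<^sub>0"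
    and "\<And>z. \<exists>c. D z = (\<Sum>i\<in>I. c i *\<^sub>C b i)"
  shows "\<exists>(m::nat) w. (\<forall>j\<in>{1..m}. w j \<in> X) \<and> (\<forall>z. D z = (\<Sum>j=1..m. cinner z (w j) *\<^sub>C w j))"
  using assms(3-)
\<comment> \<open>The induction counts spanning vectors rather than the rank, so the
  \<open>b i\<close> may be linearly dependent.\<close>
proof (induction "card I" arbitrary: I b D)
  case 0
  then have "D z = 0" for z
    by simp
  then show ?case
    by (intro exI[of _ 0]) simp
next
  case (Suc n)
  note D_X = Suc.prems(1) and I = Suc.prems(2) and bX = Suc.prems(3)
    and add = Suc.prems(4) and scale = Suc.prems(5) and pos = Suc.prems(6) and range = Suc.prems(7)
  have herm: "cinner y (D z) = cinner (D y) z" for y z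
    by (rule positive_form_hermitian[OF add scale pos])
  show ?case
  proof (cases "\<forall>y. cinner (D y) y = 0")
    case True
    then have "D z = 0" for z
      using zero_form_zero[of D] add scale by blast
    then show ?thesis
      by (intro exI[of _ 0]) simp
  next
    case False
    then obtain y where y: "cinner (D y) y \<noteq> 0"
      by blast
    define r where "r = Re (cinner (D y) y)"
    have ry: "cinner (D y) y = of_real r" and r: "0 < r"
      using pos[of y] y by (auto simp: r_def complex_nonneg_Reals_iff complex_eq_iff)
    define v where "v = (1 / complex_of_real (sqrt r)) *\<^sub>C D y"
    have vX: "v \<in> X"
      unfolding v_def by (intro X_scale D_X)
    define s where "s z = cinner (D z) y / of_real r" for z
    have v: "cinner z v *\<^sub>C v = s z *\<^sub>C D y" for z
    proof -
      have "complex_of_real (sqrt r) * complex_of_real (sqrt r) = complex_of_real r"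
        using r by (simp flip: of_real_mult)
      then show ?thesis
        by (simp add: v_def s_def cinner_scaleC_right scaleC_scaleC herm)
    qed
    define D' where "D' z = D z - cinner z v *\<^sub>C v" for z
    have D_diff: "D (p - q) = D p - D q" for p q
      using add[of "p - q" q] by simp
    \<comment> \<open>The coefficient \<open>s z\<close> makes \<open>z - s z *\<^sub>C y\<close>
      orthogonal to \<open>y\<close> for the form of \<open>D\<close>. Hence \<open>D'\<close> is
      \<open>D\<close> after this projection, and its form inherits positivity.\<close>
    have D'_eq: "D' z = D (z - s z *\<^sub>C y)" for z
      by (simp add: D'_def v D_diff scale)
    have D'y: "cinner (D' z) y = 0" for z
      using r by (simp add: D'_def v cinner_diff_left cinner_scaleC_left ry s_def)
    have D'_pos: "cinner (D' z) z \<in> \<real>\<^sub>\<ge>\<^sub>0" for z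
    proof -
      have "cinner (D' z) z = cinner (D' z) (z - s z *\<^sub>C y)"
        by (simp add: cinner_diff_right cinner_scaleC_right D'y)
      then show ?thesis
        using pos[of "z - s z *\<^sub>C y"] by (simp add: D'_eq)
    qed
    obtain c where c: "D y = (\<Sum>i\<in>I. c i *\<^sub>C b i)"
      using range by blast
    have "\<exists>j\<in>I. cinner (b j) y \<noteq> 0"
    proof (rule ccontr)
      assume "\<not> ?thesis"
      then have "cinner (D y) y = 0"
        unfolding c by (simp add: cinner_sum_left cinner_scaleC_left)
      with y show False ..
    qed
    then obtain j where j: "j \<in> I" "cinner (b j) y \<noteq> 0"
      by blast
    \<comment> \<open>Moving each \<open>b i\<close> along \<open>b j\<close> into the orthogonal
      complement of \<open>y\<close> changes no vector of the range of \<open>D'\<close>, which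
      already lies there, and it turns \<open>b j\<close> into zero.\<close>
    define b' where "b' i = b i - (cinner (b i) y / cinner (b j) y) *\<^sub>C b j" for i
    have "\<exists>(m::nat) w. (\<forall>j\<in>{1..m}. w j \<in> X) \<and> (\<forall>z. D' z = (\<Sum>j=1..m. cinner z (w j) *\<^sub>C w j))"
    proof (rule Suc.hyps(1)[of "I - {j}" D' b'])
      show "n = card (I - {j})"
        using Suc.hyps(2) I j(1) by simp
      show "D' z \<in> X" for z
        by (simp add: D'_eq D_X)
      show "finite (I - {j})"
        using I by simp
      show "b' i \<in> X" if "i \<in> I - {j}" for i
        unfolding b'_def using that j(1) by (intro X_diff X_scale bX) auto
      show "D' (p + q) = D' p + D' q" for p q
        by (simp add: D'_def add cinner_add_left scaleC_add_left)
      show "D' (a *\<^sub>C z) = a *\<^sub>C D' z" for a z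
        by (simp add: D'_def scale cinner_scaleC_left scaleC_diff_right scaleC_scaleC)
      show "\<exists>a. D' z = (\<Sum>i\<in>I - {j}. a i *\<^sub>C b' i)" for z
      proof -
        obtain a where a: "D' z = (\<Sum>i\<in>I. a i *\<^sub>C b i)"
          using range unfolding D'_eq by blast
        have "(\<Sum>i\<in>I. a i *\<^sub>C b' i) =
            (\<Sum>i\<in>I. a i *\<^sub>C b i) - ((\<Sum>i\<in>I. a i * cinner (b i) y) / cinner (b j) y) *\<^sub>C b j"
          by (simp add: b'_def scaleC_diff_right scaleC_scaleC sum_subtractf scaleC_sum_left sum_divide_distrib)
        also have "(\<Sum>i\<in>I. a i * cinner (b i) y) = cinner (D' z) y"
          by (simp add: a cinner_sum_left cinner_scaleC_left)
        finally have "(\<Sum>i\<in>I. a i *\<^sub>C b' i) = D' z"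
          using D'y[of z] by (simp add: a)
        moreover have "b' j = 0"
          using j by (simp add: b'_def)
        ultimately have "D' z = (\<Sum>i\<in>I - {j}. a i *\<^sub>C b' i)"
          using sum.remove[OF I j(1), of "\<lambda>i. a i *\<^sub>C b' i"] by simp
        then show ?thesis
          by blast
      qed
    qed (rule D'_pos)
    then obtain m :: nat and w where w: "\<forall>j\<in>{1..m}. w j \<in> X"
      "\<And>z. D' z = (\<Sum>j=1..m. cinner z (w j) *\<^sub>C w j)"
      by blast
    have "D z = (\<Sum>j=1..Suc m. cinner z ((w(Suc m := v)) j) *\<^sub>C (w(Suc m := v)) j)" for z
    proof -
      have "D z = D' z + cinner z v *\<^sub>C v"
        by (simp add: D'_def)
      then show ?thesis
        unfolding w(2) by simp
    qed
    moreover have "\<forall>j\<in>{1..Suc m}. (w(Suc m := v)) j \<in> X"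
      using w(1) vX by (auto simp: le_Suc_eq)
    ultimately show ?thesis
      by blast
  qed
qed

section \<open>The rank one projection and the equivalence\<close>

lemma rank_one_projection_apply:
  fixes x :: "'a::chilbert_space"
  assumes E: "orthogonal_projection_onto E {c *\<^sub>C x | c. True}" and x: "norm x = 1"
  shows "blinfun_apply E y = cinner y x *\<^sub>C x"
proof -
  have EB: "E \<in> bounded_operators" and EE: "E o\<^sub>L E = E" and Eadj: "adjoint_op E = E"
    and range: "range E = {c *\<^sub>C x | c. True}"
    using E by (auto simp: orthogonal_projection_onto_def)
  have "x \<in> range E"
    unfolding range by (auto intro: exI[of _ 1])
  then have Ex: "E x = x"
    using arg_cong[OF EE, of blinfun_apply] by (auto simp: fun_eq_iff)
  have "E y \<in> range E"
    by blast
  then obtain c where c: "E y = c *\<^sub>C x"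
    unfolding range by blast
  have "cinner (E y) x = cinner y x"
    using cinner_adjoint[OF EB, of y x] by (simp add: Eadj Ex)
  then show ?thesis
    by (simp add: c cinner_scaleC_left cinner_self x)
qed

theorem theorem8:
  fixes M :: "('a::chilbert_space \<Rightarrow>\<^sub>L 'a) set"
    and x :: 'a
    and E :: "'a \<Rightarrow>\<^sub>L 'a"
    and k :: nat
    and A B :: "nat \<Rightarrow> 'a \<Rightarrow>\<^sub>L 'a"
    and \<phi> :: "('a \<Rightarrow>\<^sub>L 'a) \<Rightarrow> 'a \<Rightarrow>\<^sub>L 'a"
    and D\<^sub>\<phi> :: "'a \<Rightarrow>\<^sub>L 'a"
  assumes "factor M"
    and "norm x = 1"
    and "separating_vector M x"
    and "cyclic_vector M x"
    and "orthogonal_projection_onto E {c *\<^sub>C x | c. True}"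
    and "\<And>i. i \<in> {1..k} \<Longrightarrow> A i \<in> M"
    and "\<And>i. i \<in> {1..k} \<Longrightarrow> B i \<in> M"
    and "\<And>C. C \<in> M \<Longrightarrow> \<phi> C = (\<Sum>i=1..k. A i o\<^sub>L C o\<^sub>L B i)"
    and "D\<^sub>\<phi> = (\<Sum>i=1..k. B i o\<^sub>L E o\<^sub>L A i)"
  shows "positive_operator D\<^sub>\<phi> \<longleftrightarrow>
    (\<exists>(m::nat) V. (\<forall>j\<in>{1..m}. V j \<in> M) \<and>
      (\<forall>C\<in>M. \<phi> C = (\<Sum>j=1..m. adjoint_op (V j) o\<^sub>L C o\<^sub>L V j)))"
proof -
  note A = assms(6) and B = assms(7) and \<phi> = assms(8) and sep = assms(3)
  have vNM: "von_neumann_algebra M"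
    using assms(1) by (simp add: factor_def)
  then have MB: "M \<subseteq> bounded_operators" and Madj: "\<And>C. C \<in> M \<Longrightarrow> adjoint_op C \<in> M"
    and Mcc: "commutant (commutant M) = M"
    by (auto simp: von_neumann_algebra_def)
  have M_bdd: "C \<in> bounded_operators" if "C \<in> M" for C
    using that MB by blast
  have combination: "\<exists>W\<in>M. \<forall>z. W z = (\<Sum>i\<in>I. c i *\<^sub>C T i z)"
    if "\<And>i. i \<in> I \<Longrightarrow> T i \<in> M" for I :: "nat set" and c T
    using complex_combination_in_commutant[of I T "commutant M" c] that commutant_bounded
    unfolding Mcc by blast
  have Muminus: "- C \<in> M" if "C \<in> M" for C
  proof -
    have "\<exists>W\<in>M. \<forall>z. W z = (\<Sum>i\<in>{0::nat}. (- 1) *\<^sub>C C z)"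
      by (rule combination) (use that in simp)
    then obtain W where "W \<in> M" "\<And>z. W z = - C z"
      by (auto simp: scaleC_minus_left)
    moreover from this have "W = - C"
      by (intro blinfun_eqI) (simp add: scaleC_minus_left blinfun.minus_left)
    ultimately show ?thesis
      by simp
  qed
  have D: "D\<^sub>\<phi> y = (\<Sum>i=1..k. cinner (A i y) x *\<^sub>C B i x)" for y
    by (simp add: assms(9) blinfun.sum_left rank_one_projection_apply[OF assms(5,2)]
        bounded_operator_scaleC[OF M_bdd[OF B]])
  have DB: "D\<^sub>\<phi> \<in> bounded_operators"
    by (simp add: bounded_operators_def D bounded_operator_scaleC[OF M_bdd[OF A]]
        cinner_scaleC_left scaleC_sum_right scaleC_scaleC)
  \<comment> \<open>The difference of the two representations is itself an elementary operator with
    coefficients in M, the sign being put on the right factors.\<close>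
  have eq_comp: "(\<Sum>i\<in>{1..k} <+> {1..m}. case_sum A (\<lambda>j. adjoint_op (V j)) i o\<^sub>L C o\<^sub>L case_sum B (\<lambda>j. - V j) i)
      = (\<Sum>i=1..k. A i o\<^sub>L C o\<^sub>L B i) - (\<Sum>j=1..m. adjoint_op (V j) o\<^sub>L C o\<^sub>L V j)" for m :: nat and V C
    by (simp add: sum.Plus bounded_bilinear.minus_right[OF bounded_bilinear_blinfun_compose] sum_negf)
  show ?thesis
  proof
    assume "positive_operator D\<^sub>\<phi>"
    then have pos: "cinner (D\<^sub>\<phi> y) y \<in> \<real>\<^sub>\<ge>\<^sub>0" for y
      by (simp add: positive_operator_def)
    \<comment> \<open>The Cholesky vectors must stay in this subspace, the orbit of \<open>x\<close>
      under M: only then is each \<open>w j\<close> of the form \<open>V j x\<close> with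
      \<open>V j\<close> in M.\<close>
    define X where "X = {blinfun_apply W x | W. W \<in> M}"
    have X_sum: "(\<Sum>i\<in>I. c i *\<^sub>C z i) \<in> X" if "\<And>i. i \<in> I \<Longrightarrow> z i \<in> X" for I :: "nat set" and c z
    proof -
      have "\<forall>i\<in>I. \<exists>W. W \<in> M \<and> z i = W x"
        using that by (auto simp: X_def)
      then obtain T where T: "\<And>i. i \<in> I \<Longrightarrow> T i \<in> M" "\<And>i. i \<in> I \<Longrightarrow> z i = T i x"
        by metis
      obtain W where "W \<in> M" "\<forall>z. W z = (\<Sum>i\<in>I. c i *\<^sub>C T i z)"
        using combination[of I T c] T(1) by blast
      then show ?thesis
        unfolding X_def by (auto simp: T(2) intro!: exI[of _ W])
    qed
    have BX: "B i x \<in> X" if "i \<in> {1..k}" for i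
      using B[OF that] by (auto simp: X_def)
    have "\<exists>(m::nat) w. (\<forall>j\<in>{1..m}. w j \<in> X) \<and> (\<forall>z. D\<^sub>\<phi> z = (\<Sum>j=1..m. cinner z (w j) *\<^sub>C w j))"
    proof (rule positive_finite_rank_decomposition[where I = "{1..k}" and b = "\<lambda>i. B i x"])
      show "y - z \<in> X" if "y \<in> X" "z \<in> X" for y z
        using X_sum[of "{0,1}" "(\<lambda>_. z)(0 := y)" "(\<lambda>_. - 1)(0 := 1)"] that
        by (simp add: scaleC_minus_left)
      show "c *\<^sub>C z \<in> X" if "z \<in> X" for c z
        using X_sum[of "{0}" "\<lambda>_. z" "\<lambda>_. c"] that by simp
      show "D\<^sub>\<phi> z \<in> X" for z
        unfolding D by (intro X_sum BX)
      show "\<exists>c. D\<^sub>\<phi> z = (\<Sum>i\<in>{1..k}. c i *\<^sub>C B i x)" for z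
        by (rule exI[of _ "\<lambda>i. cinner (A i z) x"]) (rule D)
    qed (use BX DB pos in \<open>simp_all add: blinfun.add_right bounded_operator_scaleC\<close>)
    then obtain m :: nat and w where w: "\<forall>j\<in>{1..m}. w j \<in> X"
      and Dw: "\<And>z. D\<^sub>\<phi> z = (\<Sum>j=1..m. cinner z (w j) *\<^sub>C w j)"
      by blast
    have "\<forall>j\<in>{1..m}. \<exists>W. W \<in> M \<and> w j = W x"
      using w by (auto simp: X_def)
    then obtain V where VM: "\<And>j. j \<in> {1..m} \<Longrightarrow> V j \<in> M" and Vx: "\<And>j. j \<in> {1..m} \<Longrightarrow> w j = V j x"
      by metis
    have "\<phi> C = (\<Sum>j=1..m. adjoint_op (V j) o\<^sub>L C o\<^sub>L V j)" if C: "C \<in> M" for C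
    proof -
      have "(\<Sum>i\<in>{1..k} <+> {1..m}. case_sum A (\<lambda>j. adjoint_op (V j)) i o\<^sub>L C o\<^sub>L case_sum B (\<lambda>j. - V j) i) = 0"
      proof (rule separating_elementary_operator_zero[OF vNM sep _ _ _ _ M_bdd[OF C]])
        fix y
        \<comment> \<open>The right side is the operator that the construction of
          \<open>D\<^sub>\<phi>\<close> attaches to the map with coefficients
          \<open>adjoint_op (V j)\<close> and \<open>V j\<close>.\<close>
        have "D\<^sub>\<phi> y = (\<Sum>j=1..m. cinner (adjoint_op (V j) y) x *\<^sub>C V j x)"
          unfolding Dw by (intro sum.cong) (simp_all add: Vx cinner_adjoint'[OF M_bdd[OF VM]])
        then show "(\<Sum>i\<in>{1..k} <+> {1..m}. cinner (case_sum A (\<lambda>j. adjoint_op (V j)) i y) x *\<^sub>C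
            case_sum B (\<lambda>j. - V j) i x) = 0"
          by (simp add: sum.Plus D blinfun.minus_left scaleC_minus_right sum_negf)
      qed (use A B VM Madj Muminus in auto)
      then show ?thesis
        using \<phi>[OF C] unfolding eq_comp by simp
    qed
    with VM show "\<exists>(m::nat) V. (\<forall>j\<in>{1..m}. V j \<in> M) \<and>
        (\<forall>C\<in>M. \<phi> C = (\<Sum>j=1..m. adjoint_op (V j) o\<^sub>L C o\<^sub>L V j))"
      by blast
  next
    assume "\<exists>(m::nat) V. (\<forall>j\<in>{1..m}. V j \<in> M) \<and>
        (\<forall>C\<in>M. \<phi> C = (\<Sum>j=1..m. adjoint_op (V j) o\<^sub>L C o\<^sub>L V j))"
    then obtain m :: nat and V where VM: "\<And>j. j \<in> {1..m} \<Longrightarrow> V j \<in> M"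
      and \<phi>V: "\<And>C. C \<in> M \<Longrightarrow> \<phi> C = (\<Sum>j=1..m. adjoint_op (V j) o\<^sub>L C o\<^sub>L V j)"
      by blast
    \<comment> \<open>Of the four free vectors two are set to \<open>x\<close> and two to
      \<open>y\<close>, so that the first block of the sum is
      \<open>cinner (D\<^sub>\<phi> y) y\<close> and the second is minus a sum of squared
      moduli.\<close>
    have zero: "(\<Sum>i\<in>{1..k} <+> {1..m}. cinner (case_sum B (\<lambda>j. - V j) i x) y *
        cinner (case_sum A (\<lambda>j. adjoint_op (V j)) i y) x) = 0" for y
    proof (rule factor_elementary_operator_zero[OF assms(1)])
      fix C
      assume "C \<in> M"
      then show "(\<Sum>i\<in>{1..k} <+> {1..m}. case_sum A (\<lambda>j. adjoint_op (V j)) i o\<^sub>L C o\<^sub>L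
          case_sum B (\<lambda>j. - V j) i) = 0"
        unfolding eq_comp using \<phi> \<phi>V by simp
    qed (use A B VM Madj Muminus in auto)
    have "cinner (D\<^sub>\<phi> y) y \<in> \<real>\<^sub>\<ge>\<^sub>0" for y
    proof -
      have "cinner (D\<^sub>\<phi> y) y = (\<Sum>i=1..k. cinner (B i x) y * cinner (A i y) x)"
        by (simp add: D cinner_sum_left cinner_scaleC_left mult.commute)
      also have "\<dots> = (\<Sum>j=1..m. cinner (V j x) y * cinner (adjoint_op (V j) y) x)"
        using zero[of y] by (simp add: sum.Plus blinfun.minus_left cinner_minus_left sum_negf)
      also have "\<dots> = (\<Sum>j=1..m. of_real ((cmod (cinner (V j x) y))\<^sup>2))"
      proof (intro sum.cong refl)
        fix j
        assume "j \<in> {1..m}"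
        then have "cinner (adjoint_op (V j) y) x = cnj (cinner (V j x) y)"
          by (simp add: cinner_adjoint'[OF M_bdd[OF VM]] cinner_commute[symmetric])
        then show "cinner (V j x) y * cinner (adjoint_op (V j) y) x = of_real ((cmod (cinner (V j x) y))\<^sup>2)"
          by (simp only: complex_norm_square)
      qed
      also have "\<dots> = of_real (\<Sum>j=1..m. (cmod (cinner (V j x) y))\<^sup>2)"
        by simp
      also have "\<dots> \<in> \<real>\<^sub>\<ge>\<^sub>0"
        by (simp only: nonneg_Reals_of_real_iff) (intro sum_nonneg, simp)
      finally show ?thesis .
    qed
    with DB show "positive_operator D\<^sub>\<phi>"
      by (simp add: positive_operator_def)
  qed
qed

end
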